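(* Let $R$ be an algebraically closed field and $n>1$. (1) If $R$ has characteristic zero, then $KTR_n=TR_n=\mathcal{MT}_n$. (2) If $R$ has characteristic $p\neq0$, then $KTR_n=TR_n\subsetneq\mathcal{MT}_n$.
   Context: A polynomial $g\in R[x_1,\ldots,x_k]$ is unit-valued if $g(a)\in R^\times$ for all $a\in R^k$. Composition of $n$-tuples of polynomials: $\vec f\circ\vec g=(f_1(g_1,\ldots,g_n),\ldots,f_n(g_1,\ldots,g_n))$. $\mathcal{MT}_n$ is the monoid under $\circ$ of all tuples $(f_1,f_2+x_2u_2,\ldots,f_n+x_nu_n)$ with $f_1\in R[x_1]$ inducing a bijection of $R$ and, for $2\le i\le n$, $f_i,u_i\in R[x_1,\ldots,x_{i-1}]$ with $u_i$ unit-valued. $TR_n$ is the group of units of the monoid $\mathcal{MT}_n$. $KTR_n$ (the Jonquières, or classical triangular, group) is the group of all tuples $(a_1x_1+b_0,\ f_1(x_1)+a_2x_2,\ \ldots,\ f_{n-1}(x_1,\ldots,x_{n-1})+a_nx_n)$ with $a_1,\ldots,a_n\in R^\times$, $b_0\in R$ and $f_i\in R[x_1,\ldots,x_i]$. *)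

theory Defs
  imports
    "HOL-Library.Poly_Mapping"
    "HOL-Computational_Algebra.Computational_Algebra"
    "HOL-Algebra.Group"
begin

text \<open>
  Multivariate polynomials over \<open>'a\<close> are finitely supported maps from exponent vectors to
  coefficients, with the (convolution) ring structure of \<^theory>\<open>HOL-Library.Poly_Mapping\<close>.
  The indeterminates are numbered from \<open>0\<close>: the variable \<open>x\<^sub>i\<close> is \<open>Var (i - 1)\<close>.
\<close>

type_synonym 'a mpoly = "(nat \<Rightarrow>\<^sub>0 nat) \<Rightarrow>\<^sub>0 'a"

definition Const :: "'a :: zero \<Rightarrow> 'a mpoly" where
  "Const c = Poly_Mapping.single 0 c"

definition Var :: "nat \<Rightarrow> 'a :: zero_neq_one mpoly" where
  "Var i = Poly_Mapping.single (Poly_Mapping.single i 1) 1"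

definition polys_in :: "nat \<Rightarrow> 'a :: zero mpoly set" where
  "polys_in k = {p. \<forall>m \<in> Poly_Mapping.keys p. Poly_Mapping.keys m \<subseteq> {..<k}}"

text \<open>
  Substituting \<open>\<alpha> i\<close> for the \<open>i\<close>-th indeterminate, with coefficients mapped by \<open>h\<close>.
\<close>

definition insertion ::
    "('a :: zero \<Rightarrow> 'b :: comm_semiring_1) \<Rightarrow> (nat \<Rightarrow> 'b) \<Rightarrow> 'a mpoly \<Rightarrow> 'b" where
  "insertion h \<alpha> p =
     (\<Sum>m \<in> Poly_Mapping.keys p. h (Poly_Mapping.lookup p m) *
        (\<Prod>i \<in> Poly_Mapping.keys m. \<alpha> i ^ Poly_Mapping.lookup m i))"

definition eval_mpoly :: "(nat \<Rightarrow> 'a :: comm_semiring_1) \<Rightarrow> 'a mpoly \<Rightarrow> 'a" where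
  "eval_mpoly a p = insertion (\<lambda>c. c) a p"

definition subst_mpoly ::
    "(nat \<Rightarrow> 'a :: comm_semiring_1 mpoly) \<Rightarrow> 'a mpoly \<Rightarrow> 'a mpoly" where
  "subst_mpoly g p = insertion Const g p"

text \<open>
  A point of \<open>R\<^sup>k\<close> is given by an arbitrary \<open>a :: nat \<Rightarrow> 'a\<close>; only the coordinates of index
  below \<open>k\<close> affect the value of a polynomial in \<open>polys_in k\<close>.
\<close>

definition unit_valued :: "'a :: comm_semiring_1 mpoly \<Rightarrow> bool" where
  "unit_valued p \<longleftrightarrow> (\<forall>a. eval_mpoly a p dvd 1)"

text \<open>
  An \<open>n\<close>-tuple of polynomials in \<open>n\<close> indeterminates is a list of length \<open>n\<close> with entries in
  \<open>polys_in n\<close>.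
\<close>

definition compose_tuple ::
    "'a :: comm_semiring_1 mpoly list \<Rightarrow> 'a mpoly list \<Rightarrow> 'a mpoly list" where
  "compose_tuple f g = List.map (subst_mpoly (\<lambda>i. g ! i)) f"

definition id_tuple :: "nat \<Rightarrow> 'a :: zero_neq_one mpoly list" where
  "id_tuple n = List.map Var [0..<n]"

definition MT :: "nat \<Rightarrow> 'a :: comm_ring_1 mpoly list set" where
  "MT n = {f. length f = n \<and>
     (0 < n \<longrightarrow> f ! 0 \<in> polys_in 1 \<and> bij (\<lambda>r. eval_mpoly (\<lambda>_. r) (f ! 0))) \<and>
     (\<forall>i. 0 < i \<and> i < n \<longrightarrow>
        (\<exists>h \<in> polys_in i. \<exists>u \<in> polys_in i. unit_valued u \<and> f ! i = h + Var i * u))}"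

definition MT_monoid :: "nat \<Rightarrow> 'a :: comm_ring_1 mpoly list monoid" where
  "MT_monoid n = \<lparr>carrier = MT n, mult = compose_tuple, one = id_tuple n\<rparr>"

definition TR :: "nat \<Rightarrow> 'a :: comm_ring_1 mpoly list set" where
  "TR n = Units (MT_monoid n)"

definition KTR :: "nat \<Rightarrow> 'a :: comm_ring_1 mpoly list set" where
  "KTR n = {f. length f = n \<and>
     (0 < n \<longrightarrow> (\<exists>a b. a dvd 1 \<and> f ! 0 = Const a * Var 0 + Const b)) \<and>
     (\<forall>i. 0 < i \<and> i < n \<longrightarrow>
        (\<exists>h \<in> polys_in i. \<exists>a. a dvd 1 \<and> f ! i = h + Const a * Var i))}"

end

theory Submission
  imports Defs
begin

text \<open>
  An algebraically closed field \<open>R\<close> is infinite, so a polynomial is determined by its values and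
  all polynomial identities can be checked pointwise. Restricted to a line through the origin, a
  unit-valued polynomial has no zero, hence is constant. So a tuple in \<open>MT n\<close> lies in \<open>KTR n\<close> as
  soon as its first entry has degree one. An invertible first entry has degree one because degrees
  multiply under composition. In characteristic zero, if \<open>P\<close> is injective of degree at least two,
  then every \<open>a\<close> is a multiple root of \<open>P - P(a)\<close>, so that \<open>P'\<close> vanishes identically, which is
  impossible. In characteristic \<open>p\<close>, the Frobenius map gives the tuple \<open>(x\<^sub>1\<^sup>p, x\<^sub>2, \<dots>, x\<^sub>n)\<close>
  in \<open>MT n\<close> outside \<open>KTR n\<close>.
\<close>

subsection \<open>Evaluation and substitution\<close>

definition monom_value :: "(nat \<Rightarrow> 'a :: comm_semiring_1) \<Rightarrow> (nat \<Rightarrow>\<^sub>0 nat) \<Rightarrow> 'a" where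
  "monom_value a m = (\<Prod>i \<in> Poly_Mapping.keys m. a i ^ Poly_Mapping.lookup m i)"

lemma monom_value_superset:
  assumes "finite S" "Poly_Mapping.keys m \<subseteq> S"
  shows "monom_value a m = (\<Prod>i \<in> S. a i ^ Poly_Mapping.lookup m i)"
  unfolding monom_value_def
  by (rule prod.mono_neutral_left) (use assms in \<open>auto simp: in_keys_iff\<close>)

lemma monom_value_0 [simp]: "monom_value a 0 = 1"
  by (simp add: monom_value_def)

lemma monom_value_single [simp]: "monom_value a (Poly_Mapping.single i k) = a i ^ k"
  by (simp add: monom_value_def)

lemma monom_value_add: "monom_value a (m + m') = monom_value a m * monom_value a m'"
proof -
  let ?S = "Poly_Mapping.keys m \<union> Poly_Mapping.keys m'"
  have "monom_value a (m + m') = (\<Prod>i \<in> ?S. a i ^ Poly_Mapping.lookup (m + m') i)"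
    by (rule monom_value_superset) (auto dest: keys_add[THEN subsetD])
  also have "\<dots> = (\<Prod>i \<in> ?S. a i ^ Poly_Mapping.lookup m i) * (\<Prod>i \<in> ?S. a i ^ Poly_Mapping.lookup m' i)"
    by (simp add: lookup_add power_add prod.distrib)
  also have "\<dots> = monom_value a m * monom_value a m'"
    by (simp add: monom_value_superset[of ?S])
  finally show ?thesis .
qed

text \<open>This makes every \<open>m\<close> a character of the multiplicative monoid of points, as
  Dedekind's argument requires.\<close>

lemma monom_value_mult_point:
  "monom_value (\<lambda>i. a i * b i) m = monom_value a m * monom_value b m"
  by (simp add: monom_value_def power_mult_distrib prod.distrib)

lemma eval_mpoly_altdef:
  "eval_mpoly a p = (\<Sum>m \<in> Poly_Mapping.keys p. Poly_Mapping.lookup p m * monom_value a m)"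
  by (simp add: eval_mpoly_def insertion_def monom_value_def)

lemma eval_mpoly_0 [simp]: "eval_mpoly a 0 = 0"
  by (simp add: eval_mpoly_altdef)

lemma eval_mpoly_single [simp]:
  "eval_mpoly a (Poly_Mapping.single m c) = c * monom_value a m"
  by (simp add: eval_mpoly_altdef)

lemma eval_mpoly_Const [simp]: "eval_mpoly a (Const c) = c"
  by (simp add: Const_def)

lemma eval_mpoly_Var [simp]: "eval_mpoly a (Var i) = a i"
  by (simp add: Var_def)

lemma eval_mpoly_1 [simp]: "eval_mpoly a 1 = 1"
  using eval_mpoly_single[of a 0 1] by (simp del: eval_mpoly_single)

lemma eval_mpoly_add [simp]: "eval_mpoly a (p + q) = eval_mpoly a p + eval_mpoly a q"
  unfolding eval_mpoly_altdef
  by (rule setsum_keys_plus_distrib) (auto simp: algebra_simps)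

lemma eval_mpoly_sum [simp]: "eval_mpoly a (\<Sum>x\<in>A. f x) = (\<Sum>x\<in>A. eval_mpoly a (f x))"
  by (induction A rule: infinite_finite_induct) auto

lemma sum_single_keys:
  "p = (\<Sum>m \<in> Poly_Mapping.keys p. Poly_Mapping.single m (Poly_Mapping.lookup p m))"
proof (rule poly_mapping_eqI)
  fix k
  show "Poly_Mapping.lookup p k = Poly_Mapping.lookup
    (\<Sum>m \<in> Poly_Mapping.keys p. Poly_Mapping.single m (Poly_Mapping.lookup p m)) k"
    by (simp add: lookup_sum lookup_single when_def sum.delta in_keys_iff)
qed

lemma eval_mpoly_mult [simp]: "eval_mpoly a (p * q) = eval_mpoly a p * eval_mpoly a q"
proof -
  have "eval_mpoly a (p * q) = eval_mpoly a
     ((\<Sum>m \<in> Poly_Mapping.keys p. Poly_Mapping.single m (Poly_Mapping.lookup p m)) *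
      (\<Sum>m \<in> Poly_Mapping.keys q. Poly_Mapping.single m (Poly_Mapping.lookup q m)))"
    by (simp flip: sum_single_keys)
  also have "\<dots> = eval_mpoly a p * eval_mpoly a q"
    by (simp add: sum_product mult_single monom_value_add eval_mpoly_altdef[of a p]
        eval_mpoly_altdef[of a q] mult_ac)
  finally show ?thesis .
qed

lemma eval_mpoly_power [simp]: "eval_mpoly a (p ^ k) = eval_mpoly a p ^ k"
  by (induction k) auto

lemma eval_mpoly_prod [simp]: "eval_mpoly a (\<Prod>x\<in>A. f x) = (\<Prod>x\<in>A. eval_mpoly a (f x))"
  by (induction A rule: infinite_finite_induct) auto

text \<open>Composition of tuples thereby becomes composition of the induced maps, so that
  identities between tuples can be checked pointwise.\<close>

lemma eval_mpoly_subst [simp]: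
  "eval_mpoly a (subst_mpoly g p) = eval_mpoly (\<lambda>i. eval_mpoly a (g i)) p"
  by (simp add: subst_mpoly_def insertion_def eval_mpoly_altdef[of _ p] monom_value_def)

text \<open>No index from \<open>k\<close> on occurs in a monomial of \<open>p\<close>. The case
  \<open>k = 0\<close> yields constants; \<open>k = 1\<close> lets a point be replaced by any other
  with the same coordinate 0.\<close>

lemma eval_mpoly_cong:
  assumes "p \<in> polys_in k" "\<And>i. i < k \<Longrightarrow> a i = b i"
  shows "eval_mpoly a p = eval_mpoly b p"
proof -
  have "a i = b i" if "m \<in> Poly_Mapping.keys p" "i \<in> Poly_Mapping.keys m" for m i
    using assms that unfolding polys_in_def by blast
  then show ?thesis
    unfolding eval_mpoly_altdef monom_value_def by simp
qed

text \<open>Substituting \<open>q i\<close> for the indeterminates restricts \<open>p\<close> to a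
  polynomial curve. This serves for lines through the origin and for reading the first entry of a
  tuple as a univariate polynomial.\<close>

lemma ex_univariate:
  fixes p :: "'a :: comm_semiring_1 mpoly"
  shows "\<exists>P. \<forall>t. poly P t = eval_mpoly (\<lambda>i. poly (q i) t) p"
  by (rule exI[of _ "insertion (\<lambda>c. [:c:]) q p"])
     (simp add: insertion_def eval_mpoly_def poly_sum poly_prod)

section \<open>Polynomials in the first \<open>k\<close> indeterminates\<close>

lemma polys_in_0 [simp]: "0 \<in> polys_in k"
  by (simp add: polys_in_def)

lemma polys_in_Const [simp]: "Const c \<in> polys_in k"
  by (auto simp: polys_in_def Const_def)

lemma polys_in_1 [simp]: "(1 :: 'a :: comm_semiring_1 mpoly) \<in> polys_in k"
  by (simp add: polys_in_def)

lemma polys_in_Var [simp]: "i < k \<Longrightarrow> Var i \<in> polys_in k"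
  by (auto simp: polys_in_def Var_def)

lemma polys_in_add: "p \<in> polys_in k \<Longrightarrow> q \<in> polys_in k \<Longrightarrow> p + q \<in> polys_in k"
  unfolding polys_in_def using keys_add[of p q] by blast

lemma polys_in_mult:
  fixes p q :: "'a :: comm_semiring_1 mpoly"
  assumes "p \<in> polys_in k" "q \<in> polys_in k"
  shows "p * q \<in> polys_in k"
  unfolding polys_in_def mem_Collect_eq
proof
  fix m assume "m \<in> Poly_Mapping.keys (p * q)"
  then obtain m1 m2 where "m = m1 + m2" "m1 \<in> Poly_Mapping.keys p" "m2 \<in> Poly_Mapping.keys q"
    using keys_mult[of p q] by blast
  then show "Poly_Mapping.keys m \<subseteq> {..<k}"
    using assms keys_add[of m1 m2] unfolding polys_in_def by blast
qed

lemma polys_in_power: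
  "(p :: 'a :: comm_semiring_1 mpoly) \<in> polys_in k \<Longrightarrow> p ^ e \<in> polys_in k"
  by (induction e) (auto intro: polys_in_mult)

lemma polys_in_sum: "(\<And>x. x \<in> A \<Longrightarrow> f x \<in> polys_in k) \<Longrightarrow> sum f A \<in> polys_in k"
  by (induction A rule: infinite_finite_induct) (auto intro: polys_in_add)

lemma polys_in_prod:
  "(\<And>x. x \<in> A \<Longrightarrow> (f x :: 'a :: comm_semiring_1 mpoly) \<in> polys_in k) \<Longrightarrow> prod f A \<in> polys_in k"
  by (induction A rule: infinite_finite_induct) (auto intro: polys_in_mult)

lemma polys_in_subst:
  assumes "p \<in> polys_in j" "\<And>i. i < j \<Longrightarrow> g i \<in> polys_in k"
  shows "subst_mpoly g p \<in> polys_in k"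
  unfolding subst_mpoly_def insertion_def
  by (intro polys_in_sum polys_in_mult polys_in_prod polys_in_power polys_in_Const assms(2))
     (use assms(1) in \<open>auto simp: polys_in_def\<close>)

lemma polys_in_mono: "p \<in> polys_in j \<Longrightarrow> j \<le> k \<Longrightarrow> p \<in> polys_in k"
  unfolding polys_in_def by (fastforce simp: subset_iff)

subsection \<open>Polynomials over infinite and over algebraically closed fields\<close>

text \<open>Euclid's trick: over a finite field, the product of all \<open>X - a\<close> plus 1 has
  positive degree and takes the value 1 everywhere, so it has no root.\<close>

lemma infinite_UNIV_alg_closed: "infinite (UNIV :: 'a :: alg_closed_field set)"
proof
  assume fin: "finite (UNIV :: 'a set)"
  define P :: "'a poly" where "P = (\<Prod>a\<in>UNIV. [:- a, 1:]) + 1"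
  have deg: "degree (\<Prod>a\<in>(UNIV :: 'a set). [:- a, 1:]) = card (UNIV :: 'a set)"
    by (subst degree_prod_eq_sum_degree) auto
  have "card (UNIV :: 'a set) > 0"
    using fin by (simp add: card_gt_0_iff)
  then have "degree P > 0"
    unfolding P_def using deg by (subst degree_add_eq_left) auto
  then obtain x where "poly P x = 0"
    using alg_closed_imp_poly_has_root by blast
  moreover have "poly P x = 1"
    using fin by (auto simp: P_def poly_prod)
  ultimately show False by simp
qed

lemma poly_eq_0_if_infinite:
  fixes P :: "'a :: field poly"
  assumes "infinite (UNIV :: 'a set)" "\<And>x. poly P x = 0"
  shows "P = 0"
  using assms poly_roots_finite[of P] by auto

lemma poly_eqI_infinite:
  fixes P Q :: "'a :: field poly"
  assumes "infinite (UNIV :: 'a set)" "\<And>x. poly P x = poly Q x"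
  shows "P = Q"
  using poly_eq_0_if_infinite[of "P - Q"] assms by simp

section \<open>Polynomials as functions over an infinite field\<close>

lemma ex_power_neq:
  assumes "infinite (UNIV :: 'a :: field set)" "j \<noteq> k"
  shows "\<exists>t :: 'a. t ^ j \<noteq> t ^ k"
proof (rule ccontr)
  assume "\<not> ?thesis"
  then have "monom (1 :: 'a) j = monom 1 k"
    by (intro poly_eqI_infinite assms(1)) (auto simp: poly_monom)
  then show False
    using assms(2) by (metis degree_monom_eq one_neq_zero)
qed

text \<open>
  Dedekind's independence of characters, applied to the multiplicative maps \<open>a \<mapsto> a\<^sup>m\<close>.
\<close>

lemma monom_values_independent:
  fixes c :: "(nat \<Rightarrow>\<^sub>0 nat) \<Rightarrow> 'a :: field"
  assumes inf: "infinite (UNIV :: 'a set)" and "finite K"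
    and "\<And>a. (\<Sum>m\<in>K. c m * monom_value a m) = 0"
  shows "\<forall>m\<in>K. c m = 0"
  using assms(2,3)
proof (induction K arbitrary: c rule: finite_induct)
  case empty
  then show ?case by simp
next
  case (insert k K)
  \<comment> \<open>Subtracting \<open>monom_value b k\<close> times the relation at
    \<open>a\<close> from the relation at the product point removes the term of \<open>k\<close>.
    The induction hypothesis applies to the shorter relation that remains.\<close>
  have zero: "c m * (monom_value b m - monom_value b k) = 0" if "m \<in> K" for m b
  proof -
    have "(\<Sum>m\<in>K. c m * (monom_value b m - monom_value b k) * monom_value a m) = 0" for a
    proof -
      have "(\<Sum>m\<in>insert k K. c m * monom_value (\<lambda>i. a i * b i) m)
          - monom_value b k * (\<Sum>m\<in>insert k K. c m * monom_value a m)
        = (\<Sum>m\<in>K. c m * (monom_value b m - monom_value b k) * monom_value a m)"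
        using insert.hyps by (simp add: monom_value_mult_point algebra_simps sum_subtractf sum_distrib_left)
      then show ?thesis
        by (simp only: insert.prems) simp
    qed
    then show ?thesis
      using insert.IH[of "\<lambda>m. c m * (monom_value b m - monom_value b k)"] that by blast
  qed
  have K: "c m = 0" if "m \<in> K" for m
  proof -
    have "m \<noteq> k" using that insert.hyps by auto
    then obtain i where i: "Poly_Mapping.lookup m i \<noteq> Poly_Mapping.lookup k i"
      using poly_mapping_eqI[of m k] by auto
    then obtain t :: 'a where t: "t ^ Poly_Mapping.lookup m i \<noteq> t ^ Poly_Mapping.lookup k i"
      using ex_power_neq[OF inf] by blast
    \<comment> \<open>The test point has \<open>t\<close> in coordinate \<open>i\<close>, where the
      exponents of \<open>m\<close> and \<open>k\<close> differ, and 1 elsewhere, so it separates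
      the two monomials.\<close>
    have val: "monom_value (\<lambda>j. if j = i then t else 1) m' = t ^ Poly_Mapping.lookup m' i" for m'
      by (subst monom_value_superset[of "insert i (Poly_Mapping.keys m')"])
         (auto simp: if_distrib[of "\<lambda>x. x ^ _"] prod.delta cong: if_cong)
    show ?thesis
      using zero[OF that, of "\<lambda>j. if j = i then t else 1"] t by (simp add: val)
  qed
  moreover have "c k = 0"
    using insert.prems[of "\<lambda>_. 1"] insert.hyps K by (simp add: monom_value_def)
  ultimately show ?case by blast
qed

lemma mpoly_eqI:
  fixes p q :: "'a :: field mpoly"
  assumes inf: "infinite (UNIV :: 'a set)" and eq: "\<And>a. eval_mpoly a p = eval_mpoly a q"
  shows "p = q"
proof -
  have "eval_mpoly a (p + Const (- 1) * q) = 0" for a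
    by (simp add: eq)
  then have "\<forall>m\<in>Poly_Mapping.keys (p + Const (- 1) * q). Poly_Mapping.lookup (p + Const (- 1) * q) m = 0"
    by (intro monom_values_independent[OF inf]) (simp_all add: eval_mpoly_altdef)
  then have "p + Const (- 1) * q = 0"
    by (metis in_keys_iff lookup_zero poly_mapping_eqI)
  moreover have "Const (- 1 :: 'a) = - 1"
    by (simp add: Const_def single_uminus)
  ultimately show ?thesis by simp
qed

lemmas mpoly_eqI_alg_closed = mpoly_eqI[OF infinite_UNIV_alg_closed]

lemma unit_valued_imp_Const:
  fixes u :: "'a :: alg_closed_field mpoly"
  assumes "unit_valued u"
  shows "\<exists>c. c \<noteq> 0 \<and> u = Const c"
proof -
  have nz: "eval_mpoly a u \<noteq> 0" for a
    using assms[unfolded unit_valued_def, THEN spec, of a] by auto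
  have "eval_mpoly a u = eval_mpoly (\<lambda>_. 0) u" for a
  proof -
    \<comment> \<open>\<open>P\<close> is \<open>u\<close> along the line \<open>t * a\<close>: its
      value at 1 is that of \<open>u\<close> at \<open>a\<close>, its value at 0 that of
      \<open>u\<close> at the origin. Having no zero, \<open>P\<close> is constant.\<close>
    obtain P where P: "\<And>t. poly P t = eval_mpoly (\<lambda>i. poly [:0, a i:] t) u"
      using ex_univariate[of "\<lambda>i. [:0, a i:]" u] by blast
    have "degree P = 0"
      using alg_closed_imp_poly_has_root[of P] nz by (auto simp: P)
    then have "poly P 1 = poly P 0"
      by (auto elim: degree_eq_zeroE)
    then show ?thesis by (simp add: P)
  qed
  then have "u = Const (eval_mpoly (\<lambda>_. 0) u)"
    by (intro mpoly_eqI_alg_closed) simp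
  then show ?thesis using nz by blast
qed

lemma injective_poly_degree_eq_1:
  fixes P :: "'a :: alg_closed_field poly"
  assumes char: "CHAR('a) = 0" and inj: "inj (poly P)"
  shows "degree P = 1"
proof (rule ccontr)
  assume "degree P \<noteq> 1"
  have "degree P \<noteq> 0"
  proof
    assume "degree P = 0"
    then have "poly P 0 = poly P 1"
      by (auto elim: degree_eq_zeroE)
    then have "(0 :: 'a) = 1" by (rule injD[OF inj])
    then show False by simp
  qed
  with \<open>degree P \<noteq> 1\<close> have deg: "degree P > 1" by simp
  have "poly (pderiv P) a = 0" for a
  proof -
    define c where "c = poly P a"
    have "poly (P - [:c:]) a = 0" by (simp add: c_def)
    then obtain S where "P - [:c:] = [:- a, 1:] * S"
      unfolding poly_eq_0_iff_dvd by (auto elim: dvdE)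
    then have PS: "P = [:- a, 1:] * S + [:c:]"
      by (metis diff_add_cancel)
    have "S \<noteq> 0" using PS deg by auto
    then have degS: "degree ([:- a, 1:] * S) = Suc (degree S)"
      by (subst degree_mult_eq) auto
    have "degree P = degree ([:- a, 1:] * S)"
      unfolding PS by (rule degree_add_eq_left) (simp only: degS degree_pCons_0 zero_less_Suc)
    then have "degree S > 0" using deg degS by simp
    \<comment> \<open>A root \<open>r\<close> of the cofactor is a preimage of \<open>P(a)\<close>,
      so injectivity gives \<open>r = a\<close>, and \<open>a\<close> is a multiple root of
      \<open>P - P(a)\<close>.\<close>
    then obtain r where r: "poly S r = 0"
      using alg_closed_imp_poly_has_root by blast
    then have "poly P r = poly P a"
      unfolding c_def[symmetric] by (subst PS) simp
    then have "r = a" by (rule injD[OF inj])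
    moreover have "pderiv P = S + [:- a, 1:] * pderiv S"
      unfolding PS pderiv_add pderiv_mult by (simp add: pderiv_pCons)
    ultimately show ?thesis using r by simp
  qed
  then have "pderiv P = 0"
    by (intro poly_eq_0_if_infinite infinite_UNIV_alg_closed)
  \<comment> \<open>This coefficient is \<open>degree P\<close> times the leading coefficient of
    \<open>P\<close>; in characteristic zero neither factor vanishes.\<close>
  then have "coeff (pderiv P) (degree P - 1) = 0" by simp
  then have "of_nat (degree P) * lead_coeff P = 0"
    using deg by (simp add: coeff_pderiv del: of_nat_Suc)
  then have "degree P = 0 \<or> P = 0"
    using char by (auto simp: of_nat_eq_0_iff_char_dvd)
  then show False using deg by auto
qed

subsection \<open>The three classes of tuples\<close>

lemma KTR_nth_0:
  assumes "f \<in> KTR n" "0 < n"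
  obtains a b where "a dvd 1" "f ! 0 = Const a * Var 0 + Const b"
proof -
  have "\<exists>a b. a dvd 1 \<and> f ! 0 = Const a * Var 0 + Const b"
    using assms by (simp add: KTR_def)
  then show ?thesis using that by blast
qed

lemma KTR_nth:
  assumes "f \<in> KTR n" "0 < i" "i < n"
  obtains h a where "h \<in> polys_in i" "a dvd 1" "f ! i = h + Const a * Var i"
proof -
  have "\<exists>h\<in>polys_in i. \<exists>a. a dvd 1 \<and> f ! i = h + Const a * Var i"
    using assms by (simp add: KTR_def)
  then show ?thesis using that by blast
qed

lemma MT_nth:
  assumes "f \<in> MT n" "0 < i" "i < n"
  obtains h u where "h \<in> polys_in i" "u \<in> polys_in i" "unit_valued u" "f ! i = h + Var i * u"
proof -
  have "\<exists>h\<in>polys_in i. \<exists>u\<in>polys_in i. unit_valued u \<and> f ! i = h + Var i * u"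
    using assms by (simp add: MT_def)
  then show ?thesis using that by blast
qed

text \<open>Units of a field are the nonzero elements and \<open>polys_in 0\<close> consists of the
  constants, so the first entry has the same shape as the others and all indices can be treated
  alike.\<close>

lemma KTR_iff:
  fixes f :: "'a :: alg_closed_field mpoly list"
  shows "f \<in> KTR n \<longleftrightarrow> length f = n \<and>
    (\<forall>i<n. \<exists>h\<in>polys_in i. \<exists>a. a \<noteq> 0 \<and> f ! i = h + Const a * Var i)" (is "_ \<longleftrightarrow> _ \<and> ?R")
proof (intro iffI conjI)
  assume f: "f \<in> KTR n"
  then show "length f = n" by (simp add: KTR_def)
  show ?R
  proof (intro allI impI)
    fix i assume "i < n"
    show "\<exists>h\<in>polys_in i. \<exists>a. a \<noteq> 0 \<and> f ! i = h + Const a * Var i"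
    proof (cases "i = 0")
      case True
      obtain a b where ab: "a dvd 1" "f ! 0 = Const a * Var 0 + Const b"
        using KTR_nth_0[OF f] \<open>i < n\<close> True by blast
      from ab(1) have "a \<noteq> 0" by auto
      then show ?thesis
        using True ab(2) by (intro bexI[of _ "Const b"] exI[of _ a]) (simp_all add: add.commute)
    next
      case False
      then obtain h a where ha: "h \<in> polys_in i" "a dvd 1" "f ! i = h + Const a * Var i"
        using KTR_nth[OF f] \<open>i < n\<close> by blast
      from ha(2) have "a \<noteq> 0" by auto
      with ha show ?thesis by blast
    qed
  qed
next
  assume "length f = n \<and> ?R"
  then have len: "length f = n" and R: ?R by auto
  have unit: "a dvd 1" if "a \<noteq> 0" for a :: 'a
    using that by (simp add: dvd_field_iff)
  have "\<exists>a b. a dvd 1 \<and> f ! 0 = Const a * Var 0 + Const b" if pos: "0 < n"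
  proof -
    obtain h a where h: "h \<in> polys_in 0" "a \<noteq> 0" "f ! 0 = h + Const a * Var 0"
      using R[rule_format, OF pos] by blast
    have "eval_mpoly x h = eval_mpoly (\<lambda>_. 0) h" for x
      by (rule eval_mpoly_cong[OF h(1)]) simp
    then have "h = Const (eval_mpoly (\<lambda>_. 0) h)"
      by (intro mpoly_eqI_alg_closed) simp
    then have "f ! 0 = Const a * Var 0 + Const (eval_mpoly (\<lambda>_. 0) h)"
      using h(3) by (metis add.commute)
    then show ?thesis using unit[OF h(2)] by blast
  qed
  moreover have "\<exists>h\<in>polys_in i. \<exists>a. a dvd 1 \<and> f ! i = h + Const a * Var i" if "i < n" for i
    using R[rule_format, OF that] unit by blast
  ultimately show "f \<in> KTR n"
    using len by (simp add: KTR_def)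
qed

text \<open>For positive indices the unit-valued factor is a nonzero constant, so only the first
  entry is in question; there \<open>P\<close> supplies slope and constant term.\<close>

lemma MT_imp_KTR:
  fixes f :: "'a :: alg_closed_field mpoly list"
  assumes f: "f \<in> MT n" and P: "\<And>t. poly P t = eval_mpoly (\<lambda>_. t) (f ! 0)" "degree P = 1"
  shows "f \<in> KTR n"
proof -
  have "\<exists>h\<in>polys_in i. \<exists>a. a \<noteq> 0 \<and> f ! i = h + Const a * Var i" if i: "i < n" for i
  proof (cases "i = 0")
    case True
    obtain b c where P': "P = [:b, c:]" "c \<noteq> 0"
      using degree1_coeffs[OF P(2)] by blast
    have "f ! 0 \<in> polys_in 1" using f i by (auto simp: MT_def)
    then have "eval_mpoly x (f ! 0) = eval_mpoly (\<lambda>_. x 0) (f ! 0)" for x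
      by (rule eval_mpoly_cong) auto
    then have "f ! 0 = Const b + Const c * Var 0"
      by (intro mpoly_eqI_alg_closed) (simp add: P' mult.commute flip: P(1))
    then show ?thesis using True P' by auto
  next
    case False
    then obtain h u where "h \<in> polys_in i" "unit_valued u" "f ! i = h + Var i * u"
      using MT_nth[OF f _ i] by blast
    moreover obtain c where "c \<noteq> 0" "u = Const c"
      using unit_valued_imp_Const \<open>unit_valued u\<close> by blast
    ultimately show ?thesis by (metis mult.commute)
  qed
  then show ?thesis using f by (simp add: KTR_iff MT_def)
qed

text \<open>A nonzero slope makes the first entry an affine bijection, and a constant unit is
  unit-valued. The inclusion also places the inverse of a triangular tuple in
  \<open>MT n\<close>.\<close>

lemma KTR_subset_MT: "(KTR n :: 'a :: alg_closed_field mpoly list set) \<subseteq> MT n"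
proof
  fix f :: "'a mpoly list" assume f: "f \<in> KTR n"
  have "f ! 0 \<in> polys_in 1 \<and> bij (\<lambda>r. eval_mpoly (\<lambda>_. r) (f ! 0))" if pos: "0 < n"
  proof -
    obtain a b where ab: "a dvd 1" "f ! 0 = Const a * Var 0 + Const b"
      using KTR_nth_0[OF f pos] by blast
    then have "a \<noteq> 0" by auto
    then have "bij (\<lambda>r. a * r + b)"
      by (intro bij_betw_byWitness[of _ "\<lambda>s. (s - b) / a"]) auto
    then show ?thesis
      using ab by (auto intro!: polys_in_add polys_in_mult)
  qed
  moreover have "\<exists>h\<in>polys_in i. \<exists>u\<in>polys_in i. unit_valued u \<and> f ! i = h + Var i * u"
    if i: "0 < i" "i < n" for i
  proof -
    obtain h a where "h \<in> polys_in i" "a dvd 1" "f ! i = h + Const a * Var i"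
      using KTR_nth[OF f i] by blast
    then show ?thesis
      by (intro bexI[of _ h] bexI[of _ "Const a"]) (auto simp: unit_valued_def mult.commute)
  qed
  ultimately show "f \<in> MT n"
    using f by (simp add: MT_def KTR_def)
qed

section \<open>Inverses of triangular tuples\<close>

lemma compose_eq_idI:
  fixes f g :: "'a :: alg_closed_field mpoly list"
  assumes "length f = n"
    and "\<And>i x. i < n \<Longrightarrow> eval_mpoly (\<lambda>j. eval_mpoly x (g ! j)) (f ! i) = x i"
  shows "compose_tuple f g = id_tuple n"
  by (rule nth_equalityI)
     (use assms in \<open>auto simp: compose_tuple_def id_tuple_def intro!: mpoly_eqI_alg_closed\<close>)

text \<open>
  The inverse tuple is obtained by solving \<open>h\<^sub>i(y\<^sub>0, \<dots>, y\<^bsub>i-1\<^esub>) + a\<^sub>i y\<^sub>i = x\<^sub>i\<close> successively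
  for \<open>y\<^sub>i\<close>.
\<close>

lemma triangular_right_inverse:
  fixes h :: "nat \<Rightarrow> 'a :: alg_closed_field mpoly"
  assumes "\<And>i. i < n \<Longrightarrow> h i \<in> polys_in i" "\<And>i. i < n \<Longrightarrow> a i \<noteq> 0"
  shows "\<exists>G. \<forall>i<n. (\<exists>h'\<in>polys_in i. G i = h' + Const (inverse (a i)) * Var i) \<and>
    (\<forall>x. eval_mpoly (\<lambda>j. eval_mpoly x (G j)) (h i) + a i * eval_mpoly x (G i) = x i)"
  using assms
proof (induction n)
  case 0
  then show ?case by simp
next
  case (Suc n)
  have "\<exists>G. \<forall>i<n. (\<exists>h'\<in>polys_in i. G i = h' + Const (inverse (a i)) * Var i) \<and>
    (\<forall>x. eval_mpoly (\<lambda>j. eval_mpoly x (G j)) (h i) + a i * eval_mpoly x (G i) = x i)"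
    by (rule Suc.IH) (use Suc.prems in auto)
  then obtain G where "\<forall>i<n. (\<exists>h'\<in>polys_in i. G i = h' + Const (inverse (a i)) * Var i) \<and>
    (\<forall>x. eval_mpoly (\<lambda>j. eval_mpoly x (G j)) (h i) + a i * eval_mpoly x (G i) = x i)" ..
  then have G:
    "\<And>i. i < n \<Longrightarrow> \<exists>h'\<in>polys_in i. G i = h' + Const (inverse (a i)) * Var i"
    "\<And>i x. i < n \<Longrightarrow>
      eval_mpoly (\<lambda>j. eval_mpoly x (G j)) (h i) + a i * eval_mpoly x (G i) = x i"
    by blast+
  \<comment> \<open>The equation at index \<open>n\<close> is solved for the new unknown;
    \<open>h'\<close> is the part of the solution free of \<open>Var n\<close>.\<close>
  define h' where "h' = Const (- inverse (a n)) * subst_mpoly G (h n)"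
  define G' where "G' = G(n := h' + Const (inverse (a n)) * Var n)"
  have "G i \<in> polys_in n" if i: "i < n" for i
  proof -
    obtain h'' where "h'' \<in> polys_in i" "G i = h'' + Const (inverse (a i)) * Var i"
      using G(1)[OF i] by blast
    then show ?thesis
      using i by (auto intro!: polys_in_add polys_in_mult intro: polys_in_mono)
  qed
  then have h': "h' \<in> polys_in n"
    unfolding h'_def using Suc.prems by (intro polys_in_mult polys_in_subst[of _ n]) auto
  \<comment> \<open>\<open>G'\<close> differs from \<open>G\<close> only at \<open>n\<close>, an
    index that cannot occur in \<open>h i\<close> when \<open>i \<le> n\<close>. So the old
    equations survive and the new one may be read with \<open>G'\<close>.\<close>
  have cong: "eval_mpoly (\<lambda>j. eval_mpoly x (G' j)) (h i) = eval_mpoly (\<lambda>j. eval_mpoly x (G j)) (h i)"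
    if "i \<le> n" for i x
    by (rule eval_mpoly_cong[of _ i]) (use that Suc.prems in \<open>auto simp: G'_def\<close>)
  have "a n \<noteq> 0" using Suc.prems by simp
  then have "a n * eval_mpoly x (G' n) = x n - eval_mpoly (\<lambda>j. eval_mpoly x (G j)) (h n)" for x
    by (simp add: G'_def h'_def field_simps)
  then have n: "eval_mpoly (\<lambda>j. eval_mpoly x (G' j)) (h n) + a n * eval_mpoly x (G' n) = x n" for x
    by (simp add: cong)
  have "(\<exists>h'\<in>polys_in i. G' i = h' + Const (inverse (a i)) * Var i) \<and>
    (\<forall>x. eval_mpoly (\<lambda>j. eval_mpoly x (G' j)) (h i) + a i * eval_mpoly x (G' i) = x i)"
    if "i < Suc n" for i
  proof (cases "i = n")
    case True
    then show ?thesis using n h' by (auto simp: G'_def)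
  next
    case False
    with that have "i < n" by simp
    then show ?thesis using G[OF \<open>i < n\<close>] cong[of i] by (auto simp: G'_def)
  qed
  then show ?case by blast
qed

lemma KTR_subset_TR: "(KTR n :: 'a :: alg_closed_field mpoly list set) \<subseteq> TR n"
proof
  fix f :: "'a mpoly list" assume f: "f \<in> KTR n"
  then have "\<forall>i<n. \<exists>h a. h \<in> polys_in i \<and> a \<noteq> 0 \<and> f ! i = h + Const a * Var i"
    unfolding KTR_iff by blast
  then obtain h a where ha: "\<And>i. i < n \<Longrightarrow> h i \<in> polys_in i" "\<And>i. i < n \<Longrightarrow> a i \<noteq> 0"
    "\<And>i. i < n \<Longrightarrow> f ! i = h i + Const (a i) * Var i"
    by metis
  from triangular_right_inverse[of n h a, OF ha(1,2)] obtain G where G: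
    "\<And>i. i < n \<Longrightarrow> \<exists>h'\<in>polys_in i. G i = h' + Const (inverse (a i)) * Var i"
    "\<And>i x. i < n \<Longrightarrow>
      eval_mpoly (\<lambda>j. eval_mpoly x (G j)) (h i) + a i * eval_mpoly x (G i) = x i"
    by blast
  define g where "g = List.map G [0..<n]"
  have g: "g ! i = G i" if "i < n" for i
    using that by (simp add: g_def)
  have "g \<in> KTR n"
    unfolding KTR_iff
  proof (intro conjI allI impI)
    fix i assume "i < n"
    then show "\<exists>h'\<in>polys_in i. \<exists>a. a \<noteq> 0 \<and> g ! i = h' + Const a * Var i"
      using G(1)[of i] ha(2)[of i] g[of i] by (metis nonzero_imp_inverse_nonzero)
  qed (simp add: g_def)
  have "eval_mpoly (\<lambda>j. eval_mpoly x (g ! j)) (f ! i) = x i" if "i < n" for i x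
  proof -
    have "eval_mpoly (\<lambda>j. eval_mpoly x (g ! j)) (h i) = eval_mpoly (\<lambda>j. eval_mpoly x (G j)) (h i)"
      by (rule eval_mpoly_cong[OF ha(1)[OF that]]) (use that g in auto)
    then show ?thesis using G(2)[OF that] that by (simp add: ha(3) g)
  qed
  then have "compose_tuple f g = id_tuple n"
    using f by (intro compose_eq_idI) (auto simp: KTR_def)
  moreover have "compose_tuple g f = id_tuple n"
  proof (rule compose_eq_idI)
    fix i x assume "i < n"
    then show "eval_mpoly (\<lambda>j. eval_mpoly x (f ! j)) (g ! i) = x i"
    proof (induction i rule: less_induct)
      case (less i)
      let ?y = "\<lambda>j. eval_mpoly x (f ! j)"
      \<comment> \<open>By induction \<open>G j\<close> takes the value \<open>x j\<close> at
        \<open>?y\<close> for \<open>j < i\<close>. Hence both sides of the equation for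
        \<open>G i\<close> at \<open>?y\<close> contain the value of \<open>h i\<close> at
        \<open>x\<close>, and cancelling it and then \<open>a i\<close> gives the claim.\<close>
      have "eval_mpoly (\<lambda>j. eval_mpoly ?y (G j)) (h i) = eval_mpoly x (h i)"
        by (rule eval_mpoly_cong[OF ha(1)]) (use less g in auto)
      then have "a i * eval_mpoly ?y (G i) = a i * x i"
        using G(2)[of i ?y] less.prems by (simp add: ha(3))
      then show ?case using ha(2) g less.prems by simp
    qed
  qed (simp add: g_def)
  ultimately show "f \<in> TR n"
    using f \<open>g \<in> KTR n\<close> KTR_subset_MT[of n]
    unfolding TR_def Units_def MT_monoid_def by auto
qed

text \<open>The first entries \<open>P\<close> and \<open>Q\<close> of a tuple and its inverse
  satisfy \<open>P(Q) = X\<close>. Degrees multiply under composition, so \<open>P\<close> has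
  degree 1, and the other entries are settled by membership in \<open>MT n\<close>.\<close>

lemma TR_subset_KTR:
  assumes "n > 0"
  shows "(TR n :: 'a :: alg_closed_field mpoly list set) \<subseteq> KTR n"
proof
  fix f :: "'a mpoly list" assume "f \<in> TR n"
  then obtain g where f: "f \<in> MT n" and g: "g \<in> MT n" and fg: "compose_tuple f g = id_tuple n"
    unfolding TR_def Units_def MT_monoid_def by auto
  obtain P where P: "\<And>t. poly P t = eval_mpoly (\<lambda>_. t) (f ! 0)"
    using ex_univariate[of "\<lambda>_. [:0, 1:]" "f ! 0"] by auto
  obtain Q where Q: "\<And>t. poly Q t = eval_mpoly (\<lambda>_. t) (g ! 0)"
    using ex_univariate[of "\<lambda>_. [:0, 1:]" "g ! 0"] by auto
  have len: "length f = n" and f0: "f ! 0 \<in> polys_in 1"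
    using f assms by (auto simp: MT_def)
  have "poly (pcompose P Q) t = poly [:0, 1:] t" for t
  proof -
    have "eval_mpoly (\<lambda>_. t) (compose_tuple f g ! 0) = t"
      using assms by (simp add: fg id_tuple_def)
    moreover have "eval_mpoly (\<lambda>_. t) (compose_tuple f g ! 0)
        = eval_mpoly (\<lambda>j. eval_mpoly (\<lambda>_. t) (g ! j)) (f ! 0)"
      using assms len by (simp add: compose_tuple_def)
    moreover have "\<dots> = eval_mpoly (\<lambda>_. poly Q t) (f ! 0)"
      by (rule eval_mpoly_cong[OF f0]) (simp add: Q)
    ultimately show ?thesis by (simp add: poly_pcompose P)
  qed
  then have "pcompose P Q = [:0, 1:]"
    by (intro poly_eqI_infinite infinite_UNIV_alg_closed)
  then have "degree P * degree Q = 1"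
    using degree_pcompose[of P Q] by simp
  then show "f \<in> KTR n"
    using MT_imp_KTR[OF f P] by simp
qed

section \<open>Characteristic zero\<close>

lemma MT_subset_KTR:
  assumes "CHAR('a :: alg_closed_field) = 0"
  shows "(MT n :: 'a mpoly list set) \<subseteq> KTR n"
proof
  fix f :: "'a mpoly list" assume f: "f \<in> MT n"
  show "f \<in> KTR n"
  proof (cases "n = 0")
    case True
    then show ?thesis using f by (simp add: MT_def KTR_def)
  next
    case False
    obtain P where P: "\<And>t. poly P t = eval_mpoly (\<lambda>_. t) (f ! 0)"
      using ex_univariate[of "\<lambda>_. [:0, 1:]" "f ! 0"] by auto
    have "poly P = (\<lambda>r. eval_mpoly (\<lambda>_. r) (f ! 0))"
      using P by (rule ext)
    then have "inj (poly P)"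
      using f False by (simp add: MT_def bij_is_inj)
    then show ?thesis
      using MT_imp_KTR[OF f P] injective_poly_degree_eq_1[OF assms] by blast
  qed
qed

section \<open>The Frobenius map in positive characteristic\<close>

lemma bij_frobenius_alg_closed:
  assumes "CHAR('a :: alg_closed_field) \<noteq> 0"
  shows "bij (\<lambda>x :: 'a. x ^ CHAR('a))"
proof (rule bijI)
  have prime: "prime CHAR('a)"
    using assms prime_CHAR_semidom[where ?'a = 'a] by simp
  show "inj (\<lambda>x :: 'a. x ^ CHAR('a))"
  proof (rule injI)
    fix x y :: 'a assume "x ^ CHAR('a) = y ^ CHAR('a)"
    \<comment> \<open>Additivity of the Frobenius map, applied to
      \<open>x = (x - y) + y\<close>.\<close>
    moreover have "x ^ CHAR('a) = (x - y) ^ CHAR('a) + y ^ CHAR('a)"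
      using freshmans_dream[OF prime refl, of "x - y" y] by simp
    ultimately have "(x - y) ^ CHAR('a) = 0" by simp
    then show "x = y" by simp
  qed
  show "surj (\<lambda>x :: 'a. x ^ CHAR('a))"
    unfolding surj_def using nth_root_exists[of "CHAR('a)"] assms by (metis neq0_conv)
qed

text \<open>Bijectivity of Frobenius gives membership in \<open>MT n\<close>, the other entries
  having \<open>h = 0\<close> and \<open>u = 1\<close>. Membership in \<open>KTR n\<close> would
  identify \<open>X^p\<close> with an affine polynomial, whose degree is at most 1.\<close>

lemma frobenius_tuple:
  assumes p: "CHAR('a :: alg_closed_field) \<noteq> 0" and n: "n > 0"
  defines "f \<equiv> (id_tuple n)[0 := (Var 0 :: 'a mpoly) ^ CHAR('a)]"
  shows "f \<in> MT n" "f \<notin> KTR n"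
proof -
  have len: "length f = n" and f0: "f ! 0 = Var 0 ^ CHAR('a)"
    and fi: "\<And>i. 0 < i \<Longrightarrow> i < n \<Longrightarrow> f ! i = Var i"
    using n by (simp_all add: f_def id_tuple_def)
  have "\<exists>h\<in>polys_in i. \<exists>u\<in>polys_in i. unit_valued u \<and> f ! i = h + Var i * u"
    if "0 < i" "i < n" for i
    by (intro bexI[of _ 0] bexI[of _ 1]) (simp_all add: fi that unit_valued_def)
  then show "f \<in> MT n"
    using bij_frobenius_alg_closed[OF p] by (simp add: MT_def len f0 polys_in_power)
  show "f \<notin> KTR n"
  proof
    assume "f \<in> KTR n"
    then obtain a b where ab: "f ! 0 = Const a * Var 0 + Const b"
      using KTR_nth_0 n by blast
    have "poly (monom 1 CHAR('a)) t = poly [:b, a:] t" for t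
    proof -
      have "t ^ CHAR('a) = eval_mpoly (\<lambda>_. t) (f ! 0)" by (simp add: f0)
      also have "\<dots> = a * t + b" by (simp add: ab)
      finally show ?thesis by (simp add: poly_monom)
    qed
    then have "monom 1 CHAR('a) = [:b, a:]"
      by (intro poly_eqI_infinite infinite_UNIV_alg_closed)
    then have "CHAR('a) = degree [:b, a:]"
      by (metis degree_monom_eq one_neq_zero)
    then have "CHAR('a) \<le> 1"
      by (simp split: if_splits)
    moreover have "CHAR('a) > 1"
      using p prime_CHAR_semidom[where ?'a = 'a] by (intro prime_gt_1_nat) simp
    ultimately show False by simp
  qed
qed

theorem proposition4p12:
  fixes n :: nat
  assumes "n > 1"
  shows "(CHAR('a :: alg_closed_field) = 0 \<longrightarrow>
            (KTR n :: 'a mpoly list set) = TR n \<and> (TR n :: 'a mpoly list set) = MT n) \<and>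
         (CHAR('a) \<noteq> 0 \<longrightarrow>
            (KTR n :: 'a mpoly list set) = TR n \<and> (TR n :: 'a mpoly list set) \<subset> MT n)"
proof -
  have n: "n > 0" using assms by simp
  have eq: "(KTR n :: 'a mpoly list set) = TR n"
    using KTR_subset_TR TR_subset_KTR[OF n] by (rule subset_antisym)
  have char_0: "(TR n :: 'a mpoly list set) = MT n" if "CHAR('a) = 0"
    using MT_subset_KTR[OF that, of n] KTR_subset_MT[of n] eq by blast
  have char_p: "(TR n :: 'a mpoly list set) \<subset> MT n" if "CHAR('a) \<noteq> 0"
    using frobenius_tuple[OF that n] KTR_subset_MT[of n] eq by blast
  show ?thesis
    by (intro conjI impI eq char_0 char_p)
qed

end
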